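(* Let $G$ be a graph such that $V(G)$ is partitioned into maximal modules $S_1,\dots,S_m$, and let $H=G(Q_1,\dots,Q_m)$ be the clique skeleton of $G$. Let $\ell\ge\chi(G)+1$. If every proper induced subgraph of $G$ is recolorable, then $R_\ell(G)$ is connected if and only if $R_\ell(H)$ is connected.
   Context: Graphs are finite and simple. A $k$-coloring of $G$ is a map $V(G)\to\{1,\dots,k\}$ giving adjacent vertices different colors; $\chi(G)$ is the chromatic number. $R_\ell(G)$ is the graph whose vertices are the $\ell$-colorings of $G$, two adjacent if they differ on exactly one vertex. $G$ is recolorable if $R_\ell(G)$ is connected for every $\ell\ge\chi(G)+1$. A module is a non-empty $S\subseteq V(G)$ such that every vertex outside $S$ is adjacent to all or none of $S$; a maximal module is a module $S\subsetneq V(G)$ not contained in any larger module properly contained in $V(G)$. Given the partition of $V(G)$ into maximal modules $S_1,\dots,S_m$ (so for $p\ne q$, $S_p$ is either complete or anticomplete to $S_q$), the clique skeleton $G(Q_1,\dots,Q_m)$ is the graph obtained by replacing each $S_p$ by a clique $Q_p$ of size $\chi(G[S_p])$, where every vertex of $Q_p$ is adjacent to every vertex of $Q_q$ ($p\neq q$) exactly when $S_p$ is complete to $S_q$ in $G$. *)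

theory Defs
  imports
    "Graph_Theory.Digraph_Component"
    "HOL-Library.FuncSet"
    "HOL-Library.Disjoint_Sets"
begin

text \<open>
  A finite simple graph is a \<open>pair_graph\<close>: finite vertex set, arc relation symmetric and
  irreflexive. An edge \<open>uv\<close> is represented by the two arcs \<open>(u, v)\<close> and \<open>(v, u)\<close>.
  The null graph is allowed.
\<close>

text \<open>
  Colorings are extensional (\<open>undefined\<close> outside the vertex set), so that two colorings are equal
  iff they agree on all vertices.
\<close>

definition colorings :: "'a pair_pre_digraph \<Rightarrow> nat \<Rightarrow> ('a \<Rightarrow> nat) set" where
  "colorings G k = {f \<in> pverts G \<rightarrow>\<^sub>E {1..k}. \<forall>(u, v) \<in> parcs G. f u \<noteq> f v}"

definition chromatic_number :: "'a pair_pre_digraph \<Rightarrow> nat" where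
  "chromatic_number G = (LEAST k. colorings G k \<noteq> {})"

definition recoloring_graph :: "'a pair_pre_digraph \<Rightarrow> nat \<Rightarrow> ('a \<Rightarrow> nat) pair_pre_digraph" where
  "recoloring_graph G l =
    \<lparr> pverts = colorings G l,
      parcs = {(f, g). f \<in> colorings G l \<and> g \<in> colorings G l \<and>
        (\<exists>!v. v \<in> pverts G \<and> f v \<noteq> g v)} \<rparr>"

text \<open>
  The library predicate \<open>connected\<close> also requires a nonempty vertex set; this is automatic here, as
  \<open>colorings G l\<close> is nonempty for every \<open>l\<close> at least the chromatic number.
\<close>

definition recolorable :: "'a pair_pre_digraph \<Rightarrow> bool" where
  "recolorable G \<longleftrightarrow>
    (\<forall>l \<ge> chromatic_number G + 1. connected (with_proj (recoloring_graph G l)))"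

definition induced_on :: "'a pair_pre_digraph \<Rightarrow> 'a set \<Rightarrow> 'a pair_pre_digraph" where
  "induced_on G W = \<lparr> pverts = W, parcs = parcs G \<inter> W \<times> W \<rparr>"

definition graph_module :: "'a pair_pre_digraph \<Rightarrow> 'a set \<Rightarrow> bool" where
  "graph_module G S \<longleftrightarrow> S \<noteq> {} \<and> S \<subseteq> pverts G \<and>
    (\<forall>v \<in> pverts G - S. (\<forall>u \<in> S. (v, u) \<in> parcs G) \<or> (\<forall>u \<in> S. (v, u) \<notin> parcs G))"

definition maximal_module :: "'a pair_pre_digraph \<Rightarrow> 'a set \<Rightarrow> bool" where
  "maximal_module G S \<longleftrightarrow> graph_module G S \<and> S \<subset> pverts G \<and>
    \<not> (\<exists>T. graph_module G T \<and> S \<subset> T \<and> T \<subset> pverts G)"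

definition complete_to :: "'a pair_pre_digraph \<Rightarrow> 'a set \<Rightarrow> 'a set \<Rightarrow> bool" where
  "complete_to G A B \<longleftrightarrow> (\<forall>a \<in> A. \<forall>b \<in> B. (a, b) \<in> parcs G)"

text \<open>\<open>S 1, \<dots>, S m\<close> is the (indexed) partition of the vertex set into maximal modules.\<close>

definition maximal_module_partition ::
  "'a pair_pre_digraph \<Rightarrow> (nat \<Rightarrow> 'a set) \<Rightarrow> nat \<Rightarrow> bool" where
  "maximal_module_partition G S m \<longleftrightarrow>
    (\<forall>p \<in> {1..m}. maximal_module G (S p)) \<and>
    disjoint_family_on S {1..m} \<and> (\<Union>p \<in> {1..m}. S p) = pverts G"

text \<open>The clique \<open>Q\<^sub>p\<close> replacing \<open>S p\<close> is \<open>{(p, i) | i. i < chromatic_number (G[S p])}\<close>.\<close>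

definition clique_skeleton ::
  "'a pair_pre_digraph \<Rightarrow> (nat \<Rightarrow> 'a set) \<Rightarrow> nat \<Rightarrow> (nat \<times> nat) pair_pre_digraph" where
  "clique_skeleton G S m =
    (let V = (SIGMA p:{1..m}. {..<chromatic_number (induced_on G (S p))})
     in \<lparr> pverts = V,
          parcs = {((p, i), (q, j)). (p, i) \<in> V \<and> (q, j) \<in> V \<and>
            (p = q \<and> i \<noteq> j \<or> p \<noteq> q \<and> complete_to G (S p) (S q))} \<rparr>)"

lemma induced_subgraph_induced_on:
  assumes "pair_wf_digraph G" "W \<subseteq> pverts G"
  shows "induced_subgraph (with_proj (induced_on G W)) (with_proj G)"
proof -
  interpret pair_wf_digraph G by fact
  have "pair_wf_digraph (induced_on G W)"
    by unfold_locales (auto simp: induced_on_def)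
  then interpret I: pair_wf_digraph "induced_on G W" .
  have "wf_digraph (with_proj G)" "wf_digraph (with_proj (induced_on G W))"
    by unfold_locales
  then show ?thesis
    using assms(2) unfolding induced_subgraph_def subgraph_def
    by (auto simp: induced_on_def)
qed

lemma finite_colorings: "finite (pverts G) \<Longrightarrow> finite (colorings G k)"
  unfolding colorings_def by (rule finite_subset[of _ "pverts G \<rightarrow>\<^sub>E {1..k}"]) (auto intro: finite_PiE)

lemma pair_graph_recoloring_graph:
  assumes "pair_graph G"
  shows "pair_graph (recoloring_graph G l)"
proof -
  interpret pair_graph G by fact
  have fin: "finite (colorings G l)" by (intro finite_colorings pair_finite_verts)
  show ?thesis
  proof
    show "finite (parcs (recoloring_graph G l))"
      by (rule finite_subset[of _ "colorings G l \<times> colorings G l"])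
        (use fin in \<open>auto simp: recoloring_graph_def\<close>)
    have eq: "(f v \<noteq> g v) = (g v \<noteq> f v)" for f g :: "'a \<Rightarrow> nat" and v by auto
    show "symmetric (with_proj (recoloring_graph G l))"
      unfolding symmetric_def by (rule symI) (simp add: recoloring_graph_def eq)
  qed (use fin in \<open>auto simp: recoloring_graph_def\<close>)
qed

lemma pair_graph_clique_skeleton:
  assumes "pair_graph G"
  shows "pair_graph (clique_skeleton G S m)"
proof -
  interpret pair_graph G by fact
  define V where "V = (SIGMA p:{1..m}. {..<chromatic_number (induced_on G (S p))})"
  have fin: "finite V" by (auto simp: V_def)
  have sym: "(v, u) \<in> parcs G" if "(u, v) \<in> parcs G" for u v
    using pair_sym_arcs that by (auto simp: symmetric_def sym_def)
  have "clique_skeleton G S m = \<lparr> pverts = V, parcs = {((p, i), (q, j)). (p, i) \<in> V \<and> (q, j) \<in> V \<and>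
      (p = q \<and> i \<noteq> j \<or> p \<noteq> q \<and> complete_to G (S p) (S q))} \<rparr>"
    unfolding clique_skeleton_def Let_def V_def by simp
  note d = this complete_to_def
  show ?thesis
  proof
    show "finite (parcs (clique_skeleton G S m))"
      by (rule finite_subset[of _ "V \<times> V"]) (use fin in \<open>auto simp: d\<close>)
    show "symmetric (with_proj (clique_skeleton G S m))"
      unfolding symmetric_def by (rule symI) (auto simp: d intro: sym)
  qed (use fin in \<open>auto simp: d\<close>)
qed

lemma colorings_nonempty:
  assumes "pair_graph G" "k \<ge> chromatic_number G"
  shows "colorings G k \<noteq> {}"
proof -
  interpret pair_graph G by fact
  obtain h where h: "bij_betw h (pverts G) {1..card (pverts G)}"
    using finite_same_card_bij[of "pverts G" "{1..card (pverts G)}"] pair_finite_verts by auto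
  have "restrict h (pverts G) \<in> colorings G (card (pverts G))"
  proof -
    have "h u \<noteq> h v" if "(u, v) \<in> parcs G" for u v
      using that in_arcsD1[OF that] in_arcsD2[OF that] pair_no_loops[OF that] bij_betw_imp_inj_on[OF h]
      by (auto dest: inj_onD)
    then show ?thesis
      using bij_betw_apply[OF h] in_arcsD1 in_arcsD2
      by (auto simp: colorings_def simp del: atLeastAtMost_iff)
  qed
  then have "colorings G (chromatic_number G) \<noteq> {}"
    unfolding chromatic_number_def by (intro LeastI) auto
  moreover have "colorings G (chromatic_number G) \<subseteq> colorings G k"
    using assms(2) PiE_mono[of "pverts G" "\<lambda>_. {1..chromatic_number G}" "\<lambda>_. {1..k}"]
    unfolding colorings_def by auto
  ultimately show ?thesis by auto
qed

end

(*
  A coloring h of the skeleton H and a coloring f of G are compared through the color sets f(S_p) and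
  h(Q_p). If h(Q_p) is contained in f(S_p) for all p, then every recoloring step of f can be followed
  by at most one step of h that keeps the inclusions. If conversely f(S_p) is contained in h(Q_p),
  every step of h, recoloring x from a to b, is followed by recoloring the a-colored vertices of the
  corresponding module to b one after the other. Both transfers control the final coloring only up
  to its colors on each module or clique, so one aims at a coloring that leaves one of the l colors
  unused, which exists because l > chi(G). In H the unused color allows swapping two colors inside a
  clique; in G it allows recoloring a module with chi(G[S_p]) + 1 colors, where G[S_p] is recolorable.
  Finally, an arbitrary coloring of G is first reduced to chi(G[S_p]) colors on each S_p: either it
  already uses only that many there, or recolorability applies to the colors present on S_p.
*)

theory Submission
  imports Defs
begin

section \<open>Recoloring sequences and connectivity\<close>

text \<open>A step may be trivial (\<open>c = f v\<close>), unlike an arc of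
  \<open>recoloring_graph\<close>. Constructions that map steps to steps thus need no case
  distinction on whether a color really changes.\<close>

definition recolor_step :: "'a pair_pre_digraph \<Rightarrow> nat \<Rightarrow> ('a \<Rightarrow> nat) rel" where
  "recolor_step K l = {(f, g). f \<in> colorings K l \<and> g \<in> colorings K l \<and>
    (\<exists>v \<in> pverts K. \<exists>c. g = f(v := c))}"

lemma sym_recolor_steps: "sym ((recolor_step K l)\<^sup>*)"
proof (rule sym_rtrancl, rule symI)
  fix f g assume "(f, g) \<in> recolor_step K l"
  then obtain v c where *: "f \<in> colorings K l" "g \<in> colorings K l" "v \<in> pverts K" "g = f(v := c)"
    by (auto simp: recolor_step_def)
  moreover have "f = g(v := f v)" using * by auto
  ultimately show "(g, f) \<in> recolor_step K l" unfolding recolor_step_def by blast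
qed

lemma recolor_steps_in_colorings:
  assumes "(f, g) \<in> (recolor_step K l)\<^sup>*" "f \<in> colorings K l"
  shows "g \<in> colorings K l"
  using assms by (induction rule: rtrancl_induct) (auto simp: recolor_step_def)

text \<open>Arcs and steps generate the same reachability relation: every arc is a step, and every
  step is an arc or trivial. Nonemptiness comes from the library notion of connectedness.\<close>

lemma connected_recoloring_graph_iff:
  "connected (with_proj (recoloring_graph K l)) \<longleftrightarrow>
    colorings K l \<noteq> {} \<and> (\<forall>f \<in> colorings K l. \<forall>g \<in> colorings K l. (f, g) \<in> (recolor_step K l)\<^sup>*)"
proof -
  let ?C = "colorings K l" and ?R = "parcs (mk_symmetric (with_proj (recoloring_graph K l)))"
  have R: "(f, g) \<in> ?R \<longleftrightarrow> f \<in> ?C \<and> g \<in> ?C \<and> (\<exists>!v. v \<in> pverts K \<and> f v \<noteq> g v)" for f g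
    by (auto simp: mk_symmetric_def recoloring_graph_def)
  have step: "(f, g) \<in> recolor_step K l" if "(f, g) \<in> ?R" for f g
  proof -
    from that obtain v where v: "f \<in> ?C" "g \<in> ?C" "v \<in> pverts K"
      "\<And>u. u \<in> pverts K \<Longrightarrow> u \<noteq> v \<Longrightarrow> f u = g u"
      unfolding R by metis
    \<comment> \<open>Extensionality settles the points outside the vertex set, so that
      \<open>g\<close> is literally a function update of \<open>f\<close>.\<close>
    have "f \<in> extensional (pverts K)" "g \<in> extensional (pverts K)"
      using v by (auto simp: colorings_def PiE_def)
    then have "g x = (f(v := g v)) x" for x
      using v(4)[of x] by (cases "x \<in> pverts K") (auto simp: extensional_def)
    then have "g = f(v := g v)" ..
    with v show ?thesis unfolding recolor_step_def by blast
  qed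
  have arc: "f = g \<or> (f, g) \<in> ?R" if "(f, g) \<in> recolor_step K l" for f g
  proof -
    from that obtain v c where *: "f \<in> ?C" "g \<in> ?C" "v \<in> pverts K" "g = f(v := c)"
      by (auto simp: recolor_step_def)
    show ?thesis
    proof (cases "c = f v")
      case False
      then have "v \<in> pverts K \<and> f v \<noteq> g v" "\<And>u. f u \<noteq> g u \<Longrightarrow> u = v"
        using * by (auto split: if_splits)
      then show ?thesis using * unfolding R by blast
    qed (use * in simp)
  qed
  have "(f, g) \<in> rtrancl_on ?C ?R \<longleftrightarrow> (f, g) \<in> (recolor_step K l)\<^sup>*" if "f \<in> ?C" for f g
  proof
    assume "(f, g) \<in> rtrancl_on ?C ?R"
    then show "(f, g) \<in> (recolor_step K l)\<^sup>*"
      by (induction rule: rtrancl_on_induct) (auto intro: rtrancl_into_rtrancl dest: step)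
  next
    assume "(f, g) \<in> (recolor_step K l)\<^sup>*"
    then show "(f, g) \<in> rtrancl_on ?C ?R"
    proof (induction rule: rtrancl_induct)
      case base
      show ?case using that by auto
    next
      case (step y z)
      have "z \<in> ?C" using step(2) by (auto simp: recolor_step_def)
      then show ?case using step(3) arc[OF step(2)] by (auto intro: rtrancl_on_into_rtrancl_on)
    qed
  qed
  moreover have "pverts (mk_symmetric (with_proj (recoloring_graph K l))) = ?C"
    by (simp add: mk_symmetric_def recoloring_graph_def)
  ultimately show ?thesis
    unfolding connected_def strongly_connected_def reachable_def by simp
qed

text \<open>Since steps are reversible, it suffices to reach one fixed coloring from all
  others.\<close>

lemma connected_recoloring_graphI:
  assumes "c \<in> colorings K l" "\<And>d. d \<in> colorings K l \<Longrightarrow> (d, c) \<in> (recolor_step K l)\<^sup>*"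
  shows "connected (with_proj (recoloring_graph K l))"
  using assms sym_recolor_steps[of K l]
  unfolding connected_recoloring_graph_iff by (blast intro: rtrancl_trans dest: symD)

section \<open>Elementary facts on colorings and graphs\<close>

lemma colorings_mono: "k \<le> l \<Longrightarrow> colorings K k \<subseteq> colorings K l"
  using PiE_mono[of "pverts K" "\<lambda>_. {1..k}" "\<lambda>_. {1..l}"] unfolding colorings_def by auto

lemma coloring_neq: "f \<in> colorings K l \<Longrightarrow> (u, v) \<in> parcs K \<Longrightarrow> f u \<noteq> f v"
  by (auto simp: colorings_def)

lemma coloring_range: "f \<in> colorings K l \<Longrightarrow> v \<in> pverts K \<Longrightarrow> f v \<in> {1..l}"
  by (auto simp: colorings_def PiE_def Pi_def)

lemma coloring_extensional: "f \<in> colorings K l \<Longrightarrow> f \<in> extensional (pverts K)"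
  by (auto simp: colorings_def PiE_def)

lemma coloringI:
  assumes "f \<in> extensional (pverts K)" "\<And>v. v \<in> pverts K \<Longrightarrow> f v \<in> {1..l}"
    "\<And>u v. (u, v) \<in> parcs K \<Longrightarrow> f u \<noteq> f v"
  shows "f \<in> colorings K l"
  using assms by (auto simp: colorings_def PiE_def Pi_def)

lemma coloring_fewer_colors:
  assumes "f \<in> colorings K l" "\<And>v. v \<in> pverts K \<Longrightarrow> f v \<in> {1..k}"
  shows "f \<in> colorings K k"
  using assms by (auto simp: colorings_def PiE_def Pi_def)

lemma pair_graph_symD: "pair_graph K \<Longrightarrow> (u, v) \<in> parcs K \<Longrightarrow> (v, u) \<in> parcs K"
  using pair_sym_digraph.pair_sym_arcs[of K]
  by (auto simp: pair_graph_def pair_pseudo_graph_def symmetric_def sym_def)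

lemma pair_graph_loopfreeD: "pair_graph K \<Longrightarrow> (u, v) \<in> parcs K \<Longrightarrow> u \<noteq> v"
  using pair_loopfree_digraph.pair_no_loops[of K "(u, v)"]
  by (auto simp: pair_graph_def pair_digraph_def)

lemma pair_graph_vertsD:
  "pair_graph K \<Longrightarrow> (u, v) \<in> parcs K \<Longrightarrow> u \<in> pverts K \<and> v \<in> pverts K"
  using pair_wf_digraph.in_arcsD1[of K u v] pair_wf_digraph.in_arcsD2[of K u v]
  by (auto simp: pair_graph_def pair_digraph_def pair_fin_digraph_def)

lemma pair_graph_finite: "pair_graph K \<Longrightarrow> finite (pverts K)"
  by (simp add: pair_graph_def pair_digraph_def pair_fin_digraph.pair_finite_verts)

lemma pair_graph_induced_on:
  assumes "pair_graph K" "W \<subseteq> pverts K"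
  shows "pair_graph (induced_on K W)"
proof
  show "finite (pverts (induced_on K W))"
    using assms pair_graph_finite finite_subset by (fastforce simp: induced_on_def)
  then show "finite (parcs (induced_on K W))"
    by (auto simp: induced_on_def)
  show "symmetric (with_proj (induced_on K W))"
    using pair_graph_symD[OF assms(1)] by (auto simp: induced_on_def symmetric_def sym_def)
qed (use pair_graph_loopfreeD[OF assms(1)] in \<open>auto simp: induced_on_def\<close>)

section \<open>Recoloring vertices, independent sets and induced subgraphs\<close>

lemma recolor_vertex:
  assumes K: "pair_graph K" and f: "f \<in> colorings K l" and "v \<in> pverts K" "c \<in> {1..l}"
    and c: "\<And>u. (v, u) \<in> parcs K \<Longrightarrow> f u \<noteq> c"
  shows "(f, f(v := c)) \<in> recolor_step K l"
proof -
  have "f(v := c) \<in> colorings K l"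
  proof (rule coloringI)
    show "f(v := c) \<in> extensional (pverts K)"
      using coloring_extensional[OF f] \<open>v \<in> pverts K\<close> by (auto simp: extensional_def)
    show "(f(v := c)) x \<in> {1..l}" if "x \<in> pverts K" for x
      using coloring_range[OF f that] assms(4) by auto
    show "(f(v := c)) x \<noteq> (f(v := c)) y" if "(x, y) \<in> parcs K" for x y
      using coloring_neq[OF f that] that pair_graph_symD[OF K that] pair_graph_loopfreeD[OF K that] c
      by (auto dest: c)
  qed
  then show ?thesis using assms by (auto simp: recolor_step_def)
qed

text \<open>The vertices of \<open>I\<close> are recolored one at a time. Their neighbors lie
  outside \<open>I\<close>, keep their old colors throughout and so never have color
  \<open>b\<close>.\<close>

lemma recolor_independent_set:
  assumes K: "pair_graph K" and f: "f \<in> colorings K l" and I: "I \<subseteq> pverts K" and b: "b \<in> {1..l}"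
    and nb: "\<And>x y. x \<in> I \<Longrightarrow> (x, y) \<in> parcs K \<Longrightarrow> y \<notin> I \<and> f y \<noteq> b"
  shows "(f, override_on f (\<lambda>_. b) I) \<in> (recolor_step K l)\<^sup>*"
proof -
  have "finite I" using I pair_graph_finite[OF K] finite_subset by auto
  then show ?thesis
    using I nb
  proof (induction I rule: finite_induct)
    case (insert x I)
    let ?g = "override_on f (\<lambda>_. b) I"
    have IH: "(f, ?g) \<in> (recolor_step K l)\<^sup>*"
    proof (rule insert.IH)
      show "I \<subseteq> pverts K" using insert.prems(1) by simp
      show "z \<notin> I \<and> f z \<noteq> b" if "y \<in> I" "(y, z) \<in> parcs K" for y z
        using insert.prems(2)[OF _ that(2)] that(1) by simp
    qed
    moreover have "(?g, ?g(x := b)) \<in> recolor_step K l"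
    proof (rule recolor_vertex[OF K recolor_steps_in_colorings[OF IH f] _ b])
      show "x \<in> pverts K" using insert.prems by simp
      show "?g y \<noteq> b" if "(x, y) \<in> parcs K" for y
        using insert.prems(2)[OF _ that] by simp
    qed
    moreover have "?g(x := b) = override_on f (\<lambda>_. b) (insert x I)"
      by (auto simp: override_on_def)
    ultimately show ?case by (metis rtrancl_into_rtrancl)
  qed simp
qed

text \<open>A bijection from \<open>A\<close> to \<open>{1..card A}\<close> renumbers the colors, so
  the color set need not be an initial interval.\<close>

lemma chromatic_number_le_card:
  assumes K: "pair_graph K" and f: "f ` pverts K \<subseteq> A" "finite A"
    and neq: "\<And>u v. (u, v) \<in> parcs K \<Longrightarrow> f u \<noteq> f v"
  shows "chromatic_number K \<le> card A"
proof -
  obtain e where e: "bij_betw e A {1..card A}"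
    using finite_same_card_bij[of A "{1..card A}"] f by auto
  have "restrict (e \<circ> f) (pverts K) \<in> colorings K (card A)"
  proof (rule coloringI)
    show "restrict (e \<circ> f) (pverts K) v \<in> {1..card A}" if "v \<in> pverts K" for v
      using that f e bij_betw_apply[OF e, of "f v"] by auto
    show "restrict (e \<circ> f) (pverts K) u \<noteq> restrict (e \<circ> f) (pverts K) v"
      if "(u, v) \<in> parcs K" for u v
      using pair_graph_vertsD[OF K that] neq[OF that] f(1) inj_on_eq_iff[OF bij_betw_imp_inj_on[OF e]]
      by (auto simp: image_subset_iff)
  qed simp
  then show ?thesis unfolding chromatic_number_def by (intro Least_le) auto
qed

text \<open>Once the colors of \<open>A\<close> are renumbered, recolorability of the subgraph on
  \<open>W\<close> gives a path between the restrictions of \<open>f\<close> and \<open>g\<close>.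
  It can be performed inside \<open>K\<close> because the neighbors of \<open>W\<close> outside
  \<open>W\<close> avoid \<open>A\<close>.\<close>

lemma recolor_subset:
  fixes K :: "'a pair_pre_digraph"
  assumes K: "pair_graph K" and W: "W \<subseteq> pverts K" and f: "f \<in> colorings K l"
    and A: "A \<subseteq> {1..l}" and fA: "f ` W \<subseteq> A"
    and outer: "\<And>u v. (u, v) \<in> parcs K \<Longrightarrow> u \<in> W \<Longrightarrow> v \<notin> W \<Longrightarrow> f v \<notin> A"
    and rec: "recolorable (induced_on K W)" and card: "chromatic_number (induced_on K W) < card A"
    and gA: "g ` W \<subseteq> A"
    and g: "\<And>u v. (u, v) \<in> parcs K \<Longrightarrow> u \<in> W \<Longrightarrow> v \<in> W \<Longrightarrow> g u \<noteq> g v"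
  shows "(f, override_on f g W) \<in> (recolor_step K l)\<^sup>*"
proof -
  let ?K = "induced_on K W" and ?k = "card A"
  have "finite A" using A finite_subset by auto
  then obtain e where e: "bij_betw e A {1..?k}"
    using finite_same_card_bij[of A "{1..?k}"] by auto
  define d where "d = inv_into A e"
  have inj: "inj_on e A" using e by (rule bij_betw_imp_inj_on)
  have d: "bij_betw d {1..?k} A" unfolding d_def using e by (rule bij_betw_inv_into)
  have de: "d (e a) = a" if "a \<in> A" for a
    unfolding d_def using that inj by simp
  have eA: "e a \<in> {1..?k}" if "a \<in> A" for a using bij_betw_apply[OF e that] .
  have dA: "d i \<in> A" if "i \<in> {1..?k}" for i using bij_betw_apply[OF d that] .
  have dinj: "d i = d j \<longleftrightarrow> i = j" if "i \<in> {1..?k}" "j \<in> {1..?k}" for i j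
    using inj_on_eq_iff[OF bij_betw_imp_inj_on[OF d] that] .
  \<comment> \<open>\<open>F\<close> translates a coloring of the induced subgraph back into the
    colors of \<open>A\<close> and extends it by \<open>f\<close> outside \<open>W\<close>; it turns
    paths of the subgraph into paths of \<open>K\<close>.\<close>
  define F where "F = (\<lambda>\<phi>. override_on f (\<lambda>x. d (\<phi> x)) W)"
  have Kc: "pverts ?K = W" "parcs ?K = parcs K \<inter> W \<times> W" by (simp_all add: induced_on_def)
  have F_col: "F \<phi> \<in> colorings K l" if \<phi>: "\<phi> \<in> colorings ?K ?k" for \<phi>
  proof (rule coloringI)
    have r: "\<phi> x \<in> {1..?k}" if "x \<in> W" for x
      using coloring_range[OF \<phi>] that Kc by auto
    show "F \<phi> \<in> extensional (pverts K)"
      using coloring_extensional[OF f] W by (auto simp: F_def extensional_def override_on_def)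
    show "F \<phi> x \<in> {1..l}" if "x \<in> pverts K" for x
      using coloring_range[OF f that] subsetD[OF A dA[OF r]]
      by (cases "x \<in> W") (auto simp: F_def)
    show "F \<phi> x \<noteq> F \<phi> y" if "(x, y) \<in> parcs K" for x y
    proof (cases "x \<in> W \<and> y \<in> W")
      case True
      then have "\<phi> x \<noteq> \<phi> y" using coloring_neq[OF \<phi>, of x y] that Kc by auto
      then show ?thesis using True dinj r by (auto simp: F_def)
    next
      case False
      then consider "x \<in> W" "y \<notin> W" | "x \<notin> W" "y \<in> W" | "x \<notin> W" "y \<notin> W" by blast
      then show ?thesis
      proof cases
        case 1
        then have "F \<phi> x \<in> A" "F \<phi> y \<notin> A"
          using outer[OF that] dA[OF r] by (simp_all add: F_def)
        then show ?thesis by auto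
      next
        case 2
        then have "F \<phi> x \<notin> A" "F \<phi> y \<in> A"
          using outer[OF pair_graph_symD[OF K that]] dA[OF r] by (simp_all add: F_def)
        then show ?thesis by auto
      next
        case 3
        then show ?thesis using coloring_neq[OF f that] by (simp add: F_def)
      qed
    qed
  qed
  have F_step: "(F \<phi>, F \<psi>) \<in> recolor_step K l" if "(\<phi>, \<psi>) \<in> recolor_step ?K ?k" for \<phi> \<psi>
  proof -
    from that obtain v c where *: "\<phi> \<in> colorings ?K ?k" "\<psi> \<in> colorings ?K ?k" "v \<in> W" "\<psi> = \<phi>(v := c)"
      by (auto simp: recolor_step_def Kc)
    have "F \<psi> = (F \<phi>)(v := d c)" using * by (auto simp: F_def override_on_def)
    then show ?thesis using F_col[OF *(1)] F_col[OF *(2)] *(3) W by (auto simp: recolor_step_def)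
  qed
  have F_steps: "(F \<phi>, F \<psi>) \<in> (recolor_step K l)\<^sup>*" if "(\<phi>, \<psi>) \<in> (recolor_step ?K ?k)\<^sup>*" for \<phi> \<psi>
    using that by (induction rule: rtrancl_induct) (auto intro: rtrancl_into_rtrancl F_step)
  have col: "restrict (e \<circ> h) W \<in> colorings ?K ?k"
    if "h ` W \<subseteq> A" "\<And>u v. (u, v) \<in> parcs K \<Longrightarrow> u \<in> W \<Longrightarrow> v \<in> W \<Longrightarrow> h u \<noteq> h v" for h
  proof (rule coloringI)
    show "restrict (e \<circ> h) W v \<in> {1..?k}" if "v \<in> pverts ?K" for v
      using that eA[of "h v"] \<open>h ` W \<subseteq> A\<close> by (auto simp: Kc)
    show "restrict (e \<circ> h) W u \<noteq> restrict (e \<circ> h) W v" if "(u, v) \<in> parcs ?K" for u v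
      using that \<open>h ` W \<subseteq> A\<close> \<open>\<And>u v. (u, v) \<in> parcs K \<Longrightarrow> u \<in> W \<Longrightarrow> v \<in> W \<Longrightarrow> h u \<noteq> h v\<close>[of u v]
      by (auto simp: Kc inj_on_eq_iff[OF inj] image_subset_iff)
  qed (simp add: Kc)
  \<comment> \<open>\<open>card A\<close> exceeds the chromatic number of the subgraph, which is the
    range of color numbers covered by recolorability.\<close>
  have "connected (with_proj (recoloring_graph ?K ?k))"
    using rec card unfolding recolorable_def by auto
  then have "(restrict (e \<circ> f) W, restrict (e \<circ> g) W) \<in> (recolor_step ?K ?k)\<^sup>*"
    using col[of f] col[of g] fA gA g coloring_neq[OF f]
    unfolding connected_recoloring_graph_iff by blast
  then have "(F (restrict (e \<circ> f) W), F (restrict (e \<circ> g) W)) \<in> (recolor_step K l)\<^sup>*"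
    by (rule F_steps)
  moreover have "F (restrict (e \<circ> f) W) = f"
    using fA by (auto simp: F_def override_on_def fun_eq_iff image_subset_iff de)
  moreover have "F (restrict (e \<circ> g) W) = override_on f g W"
    using gA by (auto simp: F_def override_on_def fun_eq_iff image_subset_iff de)
  ultimately show ?thesis by simp
qed

section \<open>Partitions into modules and the clique skeleton\<close>

locale modular_partition =
  fixes G :: "'a pair_pre_digraph" and S :: "nat \<Rightarrow> 'a set" and m :: nat
  assumes graph: "pair_graph G"
    and modul: "p \<in> {1..m} \<Longrightarrow> graph_module G (S p)"
    and disj: "disjoint_family_on S {1..m}"
    and cover: "(\<Union>p \<in> {1..m}. S p) = pverts G"
begin

abbreviation part_chi :: "nat \<Rightarrow> nat" where
  "part_chi p \<equiv> chromatic_number (induced_on G (S p))"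

abbreviation Q :: "nat \<Rightarrow> (nat \<times> nat) set" where
  "Q p \<equiv> {p} \<times> {..<part_chi p}"

abbreviation H :: "(nat \<times> nat) pair_pre_digraph" where
  "H \<equiv> clique_skeleton G S m"

lemma part_subset: "p \<in> {1..m} \<Longrightarrow> S p \<subseteq> pverts G"
  using cover by auto

lemma finite_part: "p \<in> {1..m} \<Longrightarrow> finite (S p)"
  using part_subset pair_graph_finite[OF graph] finite_subset by blast

lemma in_part_unique: "p \<in> {1..m} \<Longrightarrow> q \<in> {1..m} \<Longrightarrow> x \<in> S p \<Longrightarrow> x \<in> S q \<Longrightarrow> p = q"
  using disj unfolding disjoint_family_on_def by blast

text \<open>The module property is applied twice: to \<open>S q\<close> as seen from
  \<open>x\<close>, then to \<open>S p\<close> as seen from an arbitrary vertex of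
  \<open>S q\<close>.\<close>

lemma complete_to_if_arc:
  assumes pq: "p \<in> {1..m}" "q \<in> {1..m}" "p \<noteq> q" and x: "x \<in> S p" and y: "y \<in> S q"
    and arc: "(x, y) \<in> parcs G"
  shows "complete_to G (S p) (S q)"
proof -
  have modD: "(v, u') \<in> parcs G"
    if "r \<in> {1..m}" "r' \<in> {1..m}" "r \<noteq> r'" "v \<in> S r'" "u \<in> S r" "u' \<in> S r" "(v, u) \<in> parcs G" for r r' v u u'
  proof -
    have "v \<in> pverts G - S r" using that part_subset in_part_unique by blast
    then show ?thesis using modul[OF that(1)] that(5-7) unfolding graph_module_def by blast
  qed
  show ?thesis
    unfolding complete_to_def
  proof (intro ballI)
    fix x' y' assume "x' \<in> S p" "y' \<in> S q"
    have "(x, y') \<in> parcs G" using modD[of q p x y y'] pq x y arc \<open>y' \<in> S q\<close> by auto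
    then have "(y', x) \<in> parcs G" by (rule pair_graph_symD[OF graph])
    then have "(y', x') \<in> parcs G"
      using modD[of p q y' x x'] pq x \<open>x' \<in> S p\<close> \<open>y' \<in> S q\<close> by auto
    then show "(x', y') \<in> parcs G" by (rule pair_graph_symD[OF graph])
  qed
qed

lemma pverts_skeleton: "pverts H = (SIGMA p:{1..m}. {..<part_chi p})"
  by (simp add: clique_skeleton_def Let_def)

lemma clique_subset: "p \<in> {1..m} \<Longrightarrow> Q p \<subseteq> pverts H"
  by (auto simp: pverts_skeleton)

lemma arc_skeleton_iff:
  "((p, i), (q, j)) \<in> parcs H \<longleftrightarrow> (p, i) \<in> pverts H \<and> (q, j) \<in> pverts H \<and>
    (p = q \<and> i \<noteq> j \<or> p \<noteq> q \<and> complete_to G (S p) (S q))"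
  by (simp add: clique_skeleton_def Let_def)

lemma skeleton_graph: "pair_graph H"
  by (rule pair_graph_clique_skeleton[OF graph])

lemma coloring_disjoint:
  assumes "f \<in> colorings G k" "p \<in> {1..m}" "q \<in> {1..m}" "complete_to G (S p) (S q)"
  shows "f ` S p \<inter> f ` S q = {}"
  using assms coloring_neq[OF assms(1)] unfolding complete_to_def by fastforce

lemma skeleton_coloring_disjoint:
  assumes "h \<in> colorings H k" "p \<in> {1..m}" "q \<in> {1..m}" "p \<noteq> q" "complete_to G (S p) (S q)"
  shows "h ` Q p \<inter> h ` Q q = {}"
proof -
  have "h x \<noteq> h y" if "x \<in> Q p" "y \<in> Q q" for x y
    using that assms(2-) by (intro coloring_neq[OF assms(1)]) (auto simp: arc_skeleton_iff pverts_skeleton)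
  then show ?thesis by blast
qed

lemma skeleton_coloring_inj:
  assumes "h \<in> colorings H k" "p \<in> {1..m}"
  shows "inj_on h (Q p)"
proof (rule inj_onI, rule ccontr)
  fix x y assume "x \<in> Q p" "y \<in> Q p" "h x = h y" "x \<noteq> y"
  then have "(x, y) \<in> parcs H" using assms(2) by (auto simp: arc_skeleton_iff pverts_skeleton)
  then show False using coloring_neq[OF assms(1)] \<open>h x = h y\<close> by blast
qed

lemma clique_colors_range:
  assumes "h \<in> colorings H k" "p \<in> {1..m}"
  shows "h ` Q p \<subseteq> {1..k}"
  by (intro image_subsetI coloring_range[OF assms(1)] subsetD[OF clique_subset[OF assms(2)]])

lemma card_clique_colors: "h \<in> colorings H k \<Longrightarrow> p \<in> {1..m} \<Longrightarrow> card (h ` Q p) = part_chi p"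
  by (simp add: card_image skeleton_coloring_inj)

text \<open>The restriction of \<open>f\<close> is a proper coloring of the part.\<close>

lemma part_chi_le_card:
  assumes "f \<in> colorings G k" "p \<in> {1..m}"
  shows "part_chi p \<le> card (f ` S p)"
proof (rule chromatic_number_le_card)
  show "pair_graph (induced_on G (S p))"
    using pair_graph_induced_on[OF graph part_subset[OF assms(2)]] .
qed (use finite_part[OF assms(2)] coloring_neq[OF assms(1)] in \<open>auto simp: induced_on_def\<close>)

section \<open>Building colorings of the graph and of the skeleton from each other\<close>

text \<open>Adjacent cliques come from complete parts, on which \<open>f\<close> already uses
  disjoint color sets; only the edges inside a clique remain, and injectivity handles those.\<close>

lemma skeleton_coloringI:
  assumes f: "f \<in> colorings G k" and h: "h \<in> extensional (pverts H)"
    and inj: "\<And>p. p \<in> {1..m} \<Longrightarrow> inj_on h (Q p)"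
    and sub: "\<And>p. p \<in> {1..m} \<Longrightarrow> h ` Q p \<subseteq> f ` S p"
  shows "h \<in> colorings H k"
proof (rule coloringI)
  have S: "h (p, i) \<in> f ` S p" if "(p, i) \<in> pverts H" for p i
    using sub[of p] that by (auto simp: pverts_skeleton)
  show "h x \<in> {1..k}" if "x \<in> pverts H" for x
  proof -
    obtain p i where x: "x = (p, i)" by (cases x)
    have "p \<in> {1..m}" using that by (auto simp: x pverts_skeleton)
    then show ?thesis using S[of p i] that coloring_range[OF f] part_subset[of p] by (auto simp: x)
  qed
  show "h x \<noteq> h y" if "(x, y) \<in> parcs H" for x y
  proof -
    obtain p i q j where xy: "x = (p, i)" "y = (q, j)" by (cases x, cases y)
    have pq: "(p, i) \<in> pverts H" "(q, j) \<in> pverts H" "p \<in> {1..m}" "q \<in> {1..m}"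
      using that by (auto simp: xy arc_skeleton_iff pverts_skeleton)
    show ?thesis
    proof (cases "p = q")
      case True
      then have "i \<noteq> j" using that by (auto simp: xy arc_skeleton_iff)
      then show ?thesis
        using inj_onD[OF inj[OF pq(3)], of "(p, i)" "(p, j)"] pq(1,2) True by (auto simp: xy pverts_skeleton)
    next
      case False
      then have "f ` S p \<inter> f ` S q = {}"
        using that coloring_disjoint[OF f pq(3,4)] by (auto simp: xy arc_skeleton_iff)
      then show ?thesis using S[OF pq(1)] S[OF pq(2)] unfolding xy by (metis IntI empty_iff)
    qed
  qed
qed (rule h)

text \<open>An edge between different parts makes these parts complete to each other, so
  \<open>h\<close> uses disjoint color sets on their cliques, and \<open>f\<close> inherits
  this.\<close>

lemma coloringI_skeleton:
  assumes h: "h \<in> colorings H k" and f: "f \<in> extensional (pverts G)"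
    and inner: "\<And>p u v. p \<in> {1..m} \<Longrightarrow> u \<in> S p \<Longrightarrow> v \<in> S p \<Longrightarrow> (u, v) \<in> parcs G \<Longrightarrow> f u \<noteq> f v"
    and sub: "\<And>p. p \<in> {1..m} \<Longrightarrow> f ` S p \<subseteq> h ` Q p"
  shows "f \<in> colorings G k"
proof (rule coloringI)
  show "f v \<in> {1..k}" if v: "v \<in> pverts G" for v
  proof -
    obtain p where p: "p \<in> {1..m}" "v \<in> S p" using v cover by blast
    have "f v \<in> h ` Q p" using sub p by blast
    then show ?thesis using clique_colors_range[OF h p(1)] by (rule rev_subsetD)
  qed
  show "f u \<noteq> f v" if arc: "(u, v) \<in> parcs G" for u v
  proof -
    obtain p q where p: "p \<in> {1..m}" "u \<in> S p" and q: "q \<in> {1..m}" "v \<in> S q"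
      using pair_graph_vertsD[OF graph arc] cover by blast
    show ?thesis
    proof (cases "p = q")
      case False
      then have "h ` Q p \<inter> h ` Q q = {}"
        using skeleton_coloring_disjoint[OF h] complete_to_if_arc p q arc by blast
      then show ?thesis using sub[OF p(1)] sub[OF q(1)] p q by blast
    qed (use inner p q arc in blast)
  qed
qed (rule f)

text \<open>On each part \<open>f\<close> shows at least as many colors as the clique has vertices,
  so distinct ones can be chosen.\<close>

lemma ex_skeleton_coloring:
  assumes f: "f \<in> colorings G k"
  obtains h where "h \<in> colorings H k" "\<And>p. p \<in> {1..m} \<Longrightarrow> h ` Q p \<subseteq> f ` S p"
proof -
  have "\<exists>e. inj_on e {..<part_chi p} \<and> e ` {..<part_chi p} \<subseteq> f ` S p" if "p \<in> {1..m}" for p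
    using card_le_inj[of "{..<part_chi p}" "f ` S p"] part_chi_le_card[OF f that] finite_part[OF that]
    by auto
  then obtain e where e: "\<And>p. p \<in> {1..m} \<Longrightarrow> inj_on (e p) {..<part_chi p}"
    "\<And>p. p \<in> {1..m} \<Longrightarrow> e p ` {..<part_chi p} \<subseteq> f ` S p"
    by metis
  define h where "h = restrict (\<lambda>(p, i). e p i) (pverts H)"
  have hQ: "h (p, i) = e p i" if "p \<in> {1..m}" "i < part_chi p" for p i
    using that by (simp add: h_def pverts_skeleton)
  have sub: "h ` Q p \<subseteq> f ` S p" if "p \<in> {1..m}" for p
    using e(2)[OF that] hQ[OF that] by auto
  have "h \<in> colorings H k"
  proof (rule skeleton_coloringI[OF f])
    show "inj_on h (Q p)" if "p \<in> {1..m}" for p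
      using e(1)[OF that] hQ[OF that] by (auto simp: inj_on_def)
  qed (use sub in \<open>auto simp: h_def\<close>)
  with sub that show ?thesis by blast
qed

text \<open>Each part is colored optimally, and its \<open>part_chi p\<close> colors are then
  replaced by the colors of the clique.\<close>

lemma ex_tight_coloring:
  assumes h: "h \<in> colorings H k"
  obtains f where "f \<in> colorings G k" "\<And>p. p \<in> {1..m} \<Longrightarrow> f ` S p \<subseteq> h ` Q p"
proof -
  have "\<exists>\<kappa>. \<kappa> \<in> colorings (induced_on G (S p)) (part_chi p)" if "p \<in> {1..m}" for p
    using colorings_nonempty[OF pair_graph_induced_on[OF graph part_subset[OF that]]] by blast
  then obtain \<kappa> where \<kappa>: "\<And>p. p \<in> {1..m} \<Longrightarrow> \<kappa> p \<in> colorings (induced_on G (S p)) (part_chi p)"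
    by metis
  obtain part where part: "\<And>x. x \<in> pverts G \<Longrightarrow> part x \<in> {1..m} \<and> x \<in> S (part x)"
    using cover by (metis UN_E)
  \<comment> \<open>Colors start at 1 but clique indices at 0, hence the shift. Since
    \<open>\<kappa>\<close> is positive on each part, the truncated subtraction loses
    nothing.\<close>
  define f where "f = restrict (\<lambda>x. h (part x, \<kappa> (part x) x - 1)) (pverts G)"
  have \<kappa>_range: "\<kappa> p x \<in> {1..part_chi p}" if "p \<in> {1..m}" "x \<in> S p" for p x
    using coloring_range[OF \<kappa>[OF that(1)]] that(2) by (simp add: induced_on_def)
  have f: "f x = h (p, \<kappa> p x - 1)" if "p \<in> {1..m}" "x \<in> S p" for p x
  proof -
    have x: "x \<in> pverts G" using that part_subset by blast
    moreover have "part x = p" using part[OF x] in_part_unique that by blast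
    ultimately show ?thesis by (simp add: f_def)
  qed
  have sub: "f ` S p \<subseteq> h ` Q p" if "p \<in> {1..m}" for p
  proof
    fix y assume "y \<in> f ` S p"
    then obtain x where x: "x \<in> S p" "y = f x" by auto
    have "(p, \<kappa> p x - 1) \<in> Q p" using \<kappa>_range[OF that x(1)] by auto
    then show "y \<in> h ` Q p" using f[OF that x(1)] x(2) by (metis imageI)
  qed
  have "f \<in> colorings G k"
  proof (rule coloringI_skeleton[OF h])
    show "f u \<noteq> f v" if p: "p \<in> {1..m}" and uv: "u \<in> S p" "v \<in> S p" "(u, v) \<in> parcs G" for p u v
    proof -
      have "\<kappa> p u \<noteq> \<kappa> p v"
        using coloring_neq[OF \<kappa>[OF p], of u v] uv by (auto simp: induced_on_def)
      then have "\<kappa> p u - 1 \<noteq> \<kappa> p v - 1"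
        using \<kappa>_range[OF p uv(1)] \<kappa>_range[OF p uv(2)] by auto
      then show ?thesis
        using inj_onD[OF skeleton_coloring_inj[OF h p], of "(p, \<kappa> p u - 1)" "(p, \<kappa> p v - 1)"]
          \<kappa>_range[OF p uv(1)] \<kappa>_range[OF p uv(2)] by (force simp: f[OF p] uv)
    qed
  qed (use sub in \<open>auto simp: f_def\<close>)
  with sub that show ?thesis by blast
qed

text \<open>The clique has exactly \<open>part_chi p\<close> colors, and \<open>f\<close> cannot use
  fewer on the part.\<close>

lemma tight_eq:
  assumes "f \<in> colorings G k" "h \<in> colorings H k'" "p \<in> {1..m}" "f ` S p \<subseteq> h ` Q p"
  shows "f ` S p = h ` Q p"
proof (rule card_seteq)
  show "card (h ` Q p) \<le> card (f ` S p)"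
    using card_clique_colors[OF assms(2,3)] part_chi_le_card[OF assms(1,3)] by simp
qed (use assms in auto)

section \<open>Following recolorings of the graph in the skeleton\<close>

lemma recolor_step_partE:
  assumes "(f, g) \<in> recolor_step G l"
  obtains p v c where "f \<in> colorings G l" "g \<in> colorings G l" "p \<in> {1..m}" "v \<in> S p" "g = f(v := c)"
  using assms cover unfolding recolor_step_def by blast

text \<open>The inclusion can fail only if the recolored vertex was the last one of its part with a
  color used by the clique. The clique vertex with that color then moves to a color that the part
  shows and the clique lacks.\<close>

lemma transfer_step:
  assumes step: "(f, f') \<in> recolor_step G l" and h: "h \<in> colorings H l"
    and compat: "\<And>p. p \<in> {1..m} \<Longrightarrow> h ` Q p \<subseteq> f ` S p"
  obtains h' where "(h, h') \<in> (recolor_step H l)\<^sup>*" "\<And>p. p \<in> {1..m} \<Longrightarrow> h' ` Q p \<subseteq> f' ` S p"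
proof -
  from step obtain p v c where f: "f \<in> colorings G l" "f' \<in> colorings G l"
    and p: "p \<in> {1..m}" "v \<in> S p" and f': "f' = f(v := c)"
    by (rule recolor_step_partE)
  have other: "f' ` S q = f ` S q" if "q \<in> {1..m}" "q \<noteq> p" for q
  proof (rule image_cong)
    show "f' x = f x" if "x \<in> S q" for x
      using in_part_unique[OF \<open>q \<in> {1..m}\<close> p(1) that] \<open>q \<noteq> p\<close> p(2) by (auto simp: f')
  qed simp
  show ?thesis
  proof (cases "h ` Q p \<subseteq> f' ` S p")
    case True
    then have "h ` Q q \<subseteq> f' ` S q" if "q \<in> {1..m}" for q
      using that compat[OF that] other[OF that] by (cases "q = p") auto
    then show ?thesis using that[of h] by simp
  next
    case False
    then obtain x where x: "x \<in> Q p" "h x \<notin> f' ` S p" by blast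
    then obtain u where u: "u \<in> S p" "h x = f u" using compat[OF p(1)] by blast
    \<comment> \<open>Any other vertex of the part keeps its color, so \<open>h x\<close> would
      still occur there.\<close>
    then have "u = v" using x(2) by (auto simp: f')
    obtain b where b: "b \<in> f' ` S p" "b \<notin> h ` Q p"
    proof -
      \<comment> \<open>Otherwise both color sets would be equal by counting, contrary to the failed
        inclusion.\<close>
      have "\<not> f' ` S p \<subseteq> h ` Q p" using tight_eq[OF f(2) h p(1)] False by blast
      with that show ?thesis by blast
    qed
    define h' where "h' = h(x := b)"
    have keep: "h' ` Q q = h ` Q q" if "q \<noteq> p" for q
      using x(1) that by (intro image_cong) (auto simp: h'_def)
    have sub_p: "h' ` Q p \<subseteq> f' ` S p"
    proof
      fix y assume "y \<in> h' ` Q p"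
      then obtain z where z: "z \<in> Q p" "y = h' z" by blast
      show "y \<in> f' ` S p"
      proof (cases "z = x")
        case False
        then have "h z \<noteq> h x" using inj_onD[OF skeleton_coloring_inj[OF h p(1)]] z(1) x(1) by blast
        moreover obtain w where w: "w \<in> S p" "h z = f w" using compat[OF p(1)] z(1) by blast
        ultimately have "w \<noteq> v" using u \<open>u = v\<close> by auto
        then show ?thesis using w z(2) False by (auto simp: h'_def f')
      qed (use z b in \<open>auto simp: h'_def\<close>)
    qed
    have sub: "h' ` Q q \<subseteq> f' ` S q" if "q \<in> {1..m}" for q
      using sub_p keep[of q] other[OF that] compat[OF that] by (cases "q = p") auto
    have xV: "x \<in> pverts H" using x(1) clique_subset[OF p(1)] by blast
    have "h' \<in> colorings H l"
    proof (rule skeleton_coloringI[OF f(2)])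
      show "h' \<in> extensional (pverts H)"
        using coloring_extensional[OF h] xV by (auto simp: h'_def extensional_def)
      show "inj_on h' (Q q)" if "q \<in> {1..m}" for q
      proof (cases "q = p")
        case True
        then show ?thesis
          using skeleton_coloring_inj[OF h p(1)] b(2) unfolding h'_def by (simp add: inj_on_fun_updI)
      next
        case False
        then have "inj_on h' (Q q) = inj_on h (Q q)"
          using x(1) by (intro inj_on_cong) (auto simp: h'_def)
        then show ?thesis using skeleton_coloring_inj[OF h that] by simp
      qed
    qed (rule sub)
    then have "(h, h') \<in> recolor_step H l"
      using h xV by (auto simp: recolor_step_def h'_def)
    then show ?thesis using that[of h'] sub by blast
  qed
qed

lemma transfer_steps:
  assumes "(f, f') \<in> (recolor_step G l)\<^sup>*" and h: "h \<in> colorings H l"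
    and "\<And>p. p \<in> {1..m} \<Longrightarrow> h ` Q p \<subseteq> f ` S p"
  shows "\<exists>h'. (h, h') \<in> (recolor_step H l)\<^sup>* \<and> (\<forall>p \<in> {1..m}. h' ` Q p \<subseteq> f' ` S p)"
  using assms(1)
proof (induction rule: rtrancl_induct)
  case base
  then show ?case using assms(3) by blast
next
  case (step y z)
  from step.IH obtain h' where h': "(h, h') \<in> (recolor_step H l)\<^sup>*"
    "\<forall>p \<in> {1..m}. h' ` Q p \<subseteq> y ` S p"
    by (elim exE conjE)
  show ?case
  proof (rule transfer_step[OF step(2) recolor_steps_in_colorings[OF h'(1) h] bspec[OF h'(2)]])
    fix h'' assume "(h', h'') \<in> (recolor_step H l)\<^sup>*"
      "\<And>p. p \<in> {1..m} \<Longrightarrow> h'' ` Q p \<subseteq> z ` S p"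
    then show ?case by (intro exI[of _ h''] conjI ballI rtrancl_trans[OF h'(1)])
  qed
qed

section \<open>Following recolorings of the skeleton in the graph\<close>

text \<open>A color class inside the part is independent, so it can change color vertex by vertex.
  The new color is absent from its neighborhood: a neighbor has the color of a clique vertex other
  than \<open>x\<close>, and \<open>h'\<close> gives that vertex a color different from that of
  \<open>x\<close>.\<close>

lemma lift_step:
  assumes step: "(h, h') \<in> recolor_step H l" and f: "f \<in> colorings G l"
    and tight: "\<And>p. p \<in> {1..m} \<Longrightarrow> f ` S p \<subseteq> h ` Q p"
  obtains f' where "(f, f') \<in> (recolor_step G l)\<^sup>*" "\<And>p. p \<in> {1..m} \<Longrightarrow> f' ` S p \<subseteq> h' ` Q p"
proof -
  from step obtain x b where h: "h \<in> colorings H l" "h' \<in> colorings H l"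
    and x: "x \<in> pverts H" and h': "h' = h(x := b)"
    by (auto simp: recolor_step_def)
  obtain p where p: "p \<in> {1..m}" and xp: "x \<in> Q p" using x by (auto simp: pverts_skeleton)
  have b: "b = h' x" by (simp add: h')
  define I where "I = {u \<in> S p. f u = h x}"
  define f' where "f' = override_on f (\<lambda>_. b) I"
  have "(f, f') \<in> (recolor_step G l)\<^sup>*"
    unfolding f'_def
  proof (rule recolor_independent_set[OF graph f])
    show "I \<subseteq> pverts G" using part_subset[OF p] by (auto simp: I_def)
    show "b \<in> {1..l}" unfolding b using coloring_range[OF h(2) x] .
    show "v \<notin> I \<and> f v \<noteq> b" if u: "u \<in> I" and arc: "(u, v) \<in> parcs G" for u v
    proof
      have neq: "f v \<noteq> h x" using coloring_neq[OF f arc] u by (auto simp: I_def)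
      then show "v \<notin> I" by (auto simp: I_def)
      obtain q where q: "q \<in> {1..m}" "v \<in> S q" using pair_graph_vertsD[OF graph arc] cover by blast
      show "f v \<noteq> b"
      proof (cases "q = p")
        case True
        then obtain y where y: "y \<in> Q p" "f v = h y" using tight[OF p] q(2) by blast
        then have "y \<noteq> x" using neq by auto
        then have "h' y \<noteq> h' x" using inj_onD[OF skeleton_coloring_inj[OF h(2) p]] y(1) xp by blast
        then show ?thesis using \<open>y \<noteq> x\<close> y(2) by (simp add: h')
      next
        case False
        then obtain y where y: "y \<in> Q q" "f v = h y" using tight[OF q(1)] q(2) by blast
        have "complete_to G (S p) (S q)"
          using complete_to_if_arc[OF p q(1) _ _ q(2) arc] False u by (auto simp: I_def)
        then have "h' ` Q p \<inter> h' ` Q q = {}"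
          using skeleton_coloring_disjoint[OF h(2) p q(1)] False by blast
        then have "h' y \<noteq> h' x" using xp y(1) by (metis IntI empty_iff imageI)
        moreover have "y \<noteq> x" using xp y(1) False by auto
        ultimately show ?thesis using y(2) by (simp add: h')
      qed
    qed
  qed
  moreover have "f' ` S q \<subseteq> h' ` Q q" if q: "q \<in> {1..m}" for q
  proof
    fix c assume "c \<in> f' ` S q"
    then obtain u where u: "u \<in> S q" "c = f' u" by blast
    show "c \<in> h' ` Q q"
    proof (cases "u \<in> I")
      case True
      then have "q = p" using in_part_unique[OF q p u(1)] by (simp add: I_def)
      then show ?thesis using u(2) xp True by (simp add: f'_def b)
    next
      case False
      obtain y where y: "y \<in> Q q" "f u = h y" using tight[OF q] u(1) by blast
      \<comment> \<open>A vertex of the part with the color \<open>h x\<close> would belong to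
        \<open>I\<close>; all remaining colors come from clique vertices on which \<open>h'\<close>
        agrees with \<open>h\<close>.\<close>
      have "y \<noteq> x"
      proof
        assume "y = x"
        then have "q = p" using y(1) xp by auto
        then show False using False u(1) y(2) \<open>y = x\<close> by (simp add: I_def)
      qed
      then have "c = h' y" using u(2) y(2) False by (simp add: f'_def h')
      then show ?thesis using y(1) by blast
    qed
  qed
  ultimately show ?thesis by (rule that)
qed

lemma lift_steps:
  assumes "(h, h') \<in> (recolor_step H l)\<^sup>*" and f: "f \<in> colorings G l"
    and "\<And>p. p \<in> {1..m} \<Longrightarrow> f ` S p \<subseteq> h ` Q p"
  shows "\<exists>f'. (f, f') \<in> (recolor_step G l)\<^sup>* \<and> (\<forall>p \<in> {1..m}. f' ` S p \<subseteq> h' ` Q p)"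
  using assms(1)
proof (induction rule: rtrancl_induct)
  case base
  then show ?case using assms(3) by blast
next
  case (step y z)
  from step.IH obtain f' where f': "(f, f') \<in> (recolor_step G l)\<^sup>*"
    "\<forall>p \<in> {1..m}. f' ` S p \<subseteq> y ` Q p"
    by (elim exE conjE)
  show ?case
  proof (rule lift_step[OF step(2) recolor_steps_in_colorings[OF f'(1) f] bspec[OF f'(2)]])
    fix f'' assume "(f', f'') \<in> (recolor_step G l)\<^sup>*"
      "\<And>p. p \<in> {1..m} \<Longrightarrow> f'' ` S p \<subseteq> z ` Q p"
    then show ?case by (intro exI[of _ f''] conjI ballI rtrancl_trans[OF f'(1)])
  qed
qed

section \<open>Permuting colors inside cliques\<close>

lemma clique_twins:
  assumes "x \<in> Q p" "y \<in> Q p" "p \<in> {1..m}" "(y, z) \<in> parcs H" "z \<noteq> x"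
  shows "(x, z) \<in> parcs H"
  using assms by (cases z) (auto simp: arc_skeleton_iff pverts_skeleton)

text \<open>Both colorings show the same colors on each clique, so they differ by permutations
  within cliques. Each round swaps two colors of one clique through the free color
  \<open>Suc k\<close>, and the number of vertices where \<open>g\<close> and \<open>g0\<close>
  disagree drops.\<close>

lemma permute_cliques:
  assumes "g \<in> colorings H k" and g0: "g0 \<in> colorings H k"
    and "\<And>p. p \<in> {1..m} \<Longrightarrow> g ` Q p \<subseteq> g0 ` Q p"
  shows "(g, g0) \<in> (recolor_step H (Suc k))\<^sup>*"
  using assms(1,3)
proof (induction "card {x \<in> pverts H. g x \<noteq> g0 x}" arbitrary: g rule: less_induct)
  case less
  note g = less.prems(1)
  show ?case
  proof (cases "\<exists>x \<in> pverts H. g x \<noteq> g0 x")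
    case False
    then have "g = g0"
      by (intro extensionalityI[OF coloring_extensional[OF g] coloring_extensional[OF g0]]) auto
    then show ?thesis by simp
  next
    case True
    then obtain x where x: "x \<in> pverts H" "g x \<noteq> g0 x" by blast
    then obtain p where p: "p \<in> {1..m}" and xp: "x \<in> Q p" by (auto simp: pverts_skeleton)
    \<comment> \<open>By counting, the inclusion is an equality, so the color wanted at
      \<open>x\<close> is held by some \<open>y\<close> in the same clique.\<close>
    have "g ` Q p = g0 ` Q p"
      using less.prems(2)[OF p] card_clique_colors[OF g p] card_clique_colors[OF g0 p]
      by (intro card_subset_eq) auto
    then have "g0 x \<in> g ` Q p" using imageI[OF xp, of g0] by (simp only:)
    then obtain y where "g0 x = g y" and yp: "y \<in> Q p" by (rule imageE)
    then have gy: "g y = g0 x" by simp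
    have y: "y \<in> pverts H" using yp clique_subset[OF p] by blast
    have "y \<noteq> x" using gy x(2) by auto
    then have xy: "(x, y) \<in> parcs H" using x(1) y xp yp by (auto simp: arc_skeleton_iff)
    have gk: "g z \<in> {1..k}" if "z \<in> pverts H" for z using coloring_range[OF g that] .
    note HG = skeleton_graph
    let ?l = "Suc k"
    define g1 where "g1 = g(x := ?l)"
    define g2 where "g2 = g1(y := g x)"
    define g3 where "g3 = g2(x := g y)"
    have gl: "g \<in> colorings H ?l" using g colorings_mono[of k ?l H] by auto
    have s1: "(g, g1) \<in> recolor_step H ?l"
      unfolding g1_def
    proof (rule recolor_vertex[OF HG gl x(1)])
      show "g z \<noteq> ?l" if "(x, z) \<in> parcs H" for z
        using gk[of z] pair_graph_vertsD[OF HG that] by auto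
    qed simp
    then have g1: "g1 \<in> colorings H ?l" by (simp add: recolor_step_def)
    have s2: "(g1, g2) \<in> recolor_step H ?l"
      unfolding g2_def
    proof (rule recolor_vertex[OF HG g1 y])
      show "g x \<in> {1..?l}" using coloring_range[OF gl x(1)] .
      show "g1 z \<noteq> g x" if "(y, z) \<in> parcs H" for z
      proof (cases "z = x")
        case True
        then show ?thesis using gk[OF x(1)] by (auto simp: g1_def)
      next
        case False
        then show ?thesis
          using coloring_neq[OF g clique_twins[OF xp yp p that False]] by (auto simp: g1_def)
      qed
    qed
    then have g2: "g2 \<in> colorings H ?l" by (simp add: recolor_step_def)
    have s3: "(g2, g3) \<in> recolor_step H ?l"
      unfolding g3_def
    proof (rule recolor_vertex[OF HG g2 x(1)])
      show "g y \<in> {1..?l}" using coloring_range[OF gl y] .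
      show "g2 z \<noteq> g y" if "(x, z) \<in> parcs H" for z
      proof (cases "z = y")
        case True
        then show ?thesis using coloring_neq[OF g xy] by (auto simp: g2_def)
      next
        case False
        moreover have "z \<noteq> x" using pair_graph_loopfreeD[OF HG that] by auto
        ultimately show ?thesis
          using coloring_neq[OF g clique_twins[OF yp xp p that False]] by (auto simp: g2_def g1_def)
      qed
    qed
    have g3: "g3 z = (if z = x then g y else if z = y then g x else g z)" for z
      using \<open>y \<noteq> x\<close> by (auto simp: g3_def g2_def g1_def)
    have "g3 \<in> colorings H ?l" using s3 by (simp add: recolor_step_def)
    \<comment> \<open>The auxiliary color is free again, as the induction hypothesis
      requires.\<close>
    then have g3k: "g3 \<in> colorings H k"
    proof (rule coloring_fewer_colors)
      show "g3 z \<in> {1..k}" if "z \<in> pverts H" for z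
        using gk[OF that] gk[OF x(1)] gk[OF y] by (simp add: g3)
    qed
    have sub: "g3 ` Q q \<subseteq> g0 ` Q q" if q: "q \<in> {1..m}" for q
    proof -
      have "g3 ` Q q \<subseteq> g ` Q q"
      proof (cases "q = p")
        case True
        then show ?thesis using xp yp by (auto simp: g3)
      next
        case False
        then have "x \<notin> Q q" "y \<notin> Q q" using xp yp by auto
        then show ?thesis by (auto simp: g3)
      qed
      then show ?thesis using less.prems(2)[OF q] by blast
    qed
    \<comment> \<open>The swap destroys no agreement: \<open>y\<close> was wrong before, and
      \<open>x\<close> is right afterwards.\<close>
    have "g y \<noteq> g0 y"
    proof
      assume "g y = g0 y"
      then have "g0 y = g0 x" using gy by simp
      then show False using coloring_neq[OF g0 xy] by simp
    qed
    then have "{z \<in> pverts H. g3 z \<noteq> g0 z} \<subset> {z \<in> pverts H. g z \<noteq> g0 z}"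
      using x y gy by (auto simp: g3 split: if_splits)
    then have "card {z \<in> pverts H. g3 z \<noteq> g0 z} < card {z \<in> pverts H. g z \<noteq> g0 z}"
      using pair_graph_finite[OF HG] by (intro psubset_card_mono) auto
    then have "(g3, g0) \<in> (recolor_step H ?l)\<^sup>*" using less.hyps[OF _ g3k sub] by blast
    then show ?thesis using s1 s2 s3 by (meson converse_rtrancl_into_rtrancl)
  qed
qed

section \<open>Recoloring within modules\<close>

lemma neighbor_outside_part:
  assumes p: "p \<in> {1..m}" and uv: "(u, v) \<in> parcs G" "u \<in> S p" "v \<notin> S p"
  obtains q where "q \<in> {1..m}" "q \<noteq> p" "v \<in> S q" "complete_to G (S p) (S q)"
proof -
  obtain q where q: "q \<in> {1..m}" "v \<in> S q" using pair_graph_vertsD[OF graph uv(1)] cover by blast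
  then have "q \<noteq> p" using uv by auto
  with q that complete_to_if_arc[OF p q(1) _ uv(2) q(2) uv(1)] show ?thesis by blast
qed

text \<open>If \<open>f\<close> uses more than \<open>part_chi p\<close> colors on the part, these
  colors alone suffice to apply recolorability there, and no neighbor outside the part has any of
  them. Otherwise \<open>f\<close> is already as required.\<close>

lemma shrink_part:
  assumes f: "f \<in> colorings G l" and p: "p \<in> {1..m}" and rec: "recolorable (induced_on G (S p))"
  obtains g where "(f, override_on f g (S p)) \<in> (recolor_step G l)\<^sup>*" "card (g ` S p) \<le> part_chi p"
proof (cases "card (f ` S p) = part_chi p")
  case True
  moreover have "override_on f f (S p) = f" by (auto simp: override_on_def)
  ultimately show ?thesis using that[of f] by simp
next
  case False
  let ?A = "f ` S p" and ?K = "induced_on G (S p)"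
  have lt: "part_chi p < card ?A" using part_chi_le_card[OF f p] False by simp
  obtain \<kappa> where \<kappa>: "\<kappa> \<in> colorings ?K (part_chi p)"
    using colorings_nonempty[OF pair_graph_induced_on[OF graph part_subset[OF p]]] by blast
  obtain e where e: "inj_on e {1..part_chi p}" "e ` {1..part_chi p} \<subseteq> ?A"
    using card_le_inj[of "{1..part_chi p}" ?A] lt finite_part[OF p] by auto
  \<comment> \<open>The target is an optimal coloring of the part written in colors already present
    on it.\<close>
  define g where "g = e \<circ> \<kappa>"
  have r: "\<kappa> u \<in> {1..part_chi p}" if "u \<in> S p" for u
    using coloring_range[OF \<kappa>] that by (simp add: induced_on_def)
  have "(f, override_on f g (S p)) \<in> (recolor_step G l)\<^sup>*"
  proof (rule recolor_subset[OF graph part_subset[OF p] f _ _ _ rec lt])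
    show "?A \<subseteq> {1..l}" using coloring_range[OF f] part_subset[OF p] by blast
    show "f v \<notin> ?A" if uv: "(u, v) \<in> parcs G" "u \<in> S p" "v \<notin> S p" for u v
    proof -
      obtain q where "q \<in> {1..m}" "v \<in> S q" "complete_to G (S p) (S q)"
        using neighbor_outside_part[OF p uv] by blast
      then show ?thesis using coloring_disjoint[OF f p] by blast
    qed
    show "g ` S p \<subseteq> ?A" using r e(2) by (auto simp: g_def simp del: atLeastAtMost_iff)
    show "g u \<noteq> g v" if "(u, v) \<in> parcs G" "u \<in> S p" "v \<in> S p" for u v
      using coloring_neq[OF \<kappa>, of u v] that inj_on_eq_iff[OF e(1) r r] by (auto simp: g_def induced_on_def)
  qed simp
  moreover have "card (g ` S p) \<le> part_chi p"
  proof -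
    have "g ` S p \<subseteq> e ` {1..part_chi p}" using r by (auto simp: g_def simp del: atLeastAtMost_iff)
    then have "card (g ` S p) \<le> card (e ` {1..part_chi p})" by (intro card_mono) auto
    also have "\<dots> \<le> part_chi p" using card_image_le[of "{1..part_chi p}" e] by simp
    finally show ?thesis .
  qed
  ultimately show ?thesis by (rule that)
qed

text \<open>The parts are treated in turn; as they are disjoint, the color counts reached earlier
  persist.\<close>

lemma shrink_parts:
  assumes f: "f \<in> colorings G l" and rec: "\<And>p. p \<in> {1..m} \<Longrightarrow> recolorable (induced_on G (S p))"
  shows "\<exists>f'. (f, f') \<in> (recolor_step G l)\<^sup>* \<and> (\<forall>p \<in> {1..m}. card (f' ` S p) \<le> part_chi p)"
proof -
  have "\<exists>f'. (f, f') \<in> (recolor_step G l)\<^sup>* \<and> (\<forall>p \<in> {1..n}. card (f' ` S p) \<le> part_chi p)" if "n \<le> m" for n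
    using that
  proof (induction n)
    case 0
    show ?case by (intro exI[of _ f]) simp
  next
    case (Suc n)
    then obtain f' where f': "(f, f') \<in> (recolor_step G l)\<^sup>*" "\<forall>p \<in> {1..n}. card (f' ` S p) \<le> part_chi p"
      by auto
    have n: "Suc n \<in> {1..m}" using Suc.prems by simp
    obtain g where g: "(f', override_on f' g (S (Suc n))) \<in> (recolor_step G l)\<^sup>*"
      "card (g ` S (Suc n)) \<le> part_chi (Suc n)"
      using shrink_part[OF recolor_steps_in_colorings[OF f'(1) f] n rec[OF n]] .
    let ?g = "override_on f' g (S (Suc n))"
    have "card (?g ` S p) \<le> part_chi p" if p: "p \<in> {1..Suc n}" for p
    proof (cases "p = Suc n")
      case True
      then have "?g ` S p = g ` S p" by (intro image_cong) auto
      then show ?thesis using g(2) True by simp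
    next
      case False
      then have "?g ` S p = f' ` S p"
        using p Suc.prems in_part_unique[OF _ n, of p] by (intro image_cong) (auto simp: override_on_def)
      then show ?thesis using f'(2) p False by auto
    qed
    then show ?case using f'(1) g(1) by (meson rtrancl_trans)
  qed
  then show ?thesis by blast
qed

lemma tight_colorings_connected:
  assumes f: "f \<in> colorings G k" and f': "f' \<in> colorings G k" and h: "h \<in> colorings H k"
    and tight: "\<And>p. p \<in> {1..m} \<Longrightarrow> f ` S p \<subseteq> h ` Q p" "\<And>p. p \<in> {1..m} \<Longrightarrow> f' ` S p \<subseteq> h ` Q p"
    and rec: "\<And>p. p \<in> {1..m} \<Longrightarrow> recolorable (induced_on G (S p))"
  shows "(f, f') \<in> (recolor_step G (Suc k))\<^sup>*"
proof -
  let ?l = "Suc k"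
  \<comment> \<open>The intermediate coloring that already follows \<open>f'\<close> on the first
    \<open>n\<close> parts. It takes its colors from those of \<open>h\<close>, so
    \<open>Suc k\<close> is free again before each new part.\<close>
  define F where "F n = override_on f f' (\<Union>p \<in> {1..n}. S p)" for n
  have F_tight: "F n u \<in> h ` Q p" if "p \<in> {1..m}" "u \<in> S p" for n p u
    using tight[OF that(1)] that(2) by (auto simp: F_def override_on_def)
  have fl: "f \<in> colorings G ?l" using f colorings_mono[of k ?l G] by auto
  have "(f, F n) \<in> (recolor_step G ?l)\<^sup>*" if "n \<le> m" for n
    using that
  proof (induction n)
    case 0
    show ?case by (simp add: F_def)
  next
    case (Suc n)
    then have IH: "(f, F n) \<in> (recolor_step G ?l)\<^sup>*" by simp
    define p where "p = Suc n"
    have p: "p \<in> {1..m}" using Suc.prems by (simp add: p_def)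
    let ?A = "insert ?l (h ` Q p)"
    have hk: "h x \<in> {1..k}" if "x \<in> Q q" "q \<in> {1..m}" for x q
      using coloring_range[OF h] clique_subset[OF that(2)] that(1) by blast
    have "?l \<notin> h ` Q p" using hk[OF _ p] by fastforce
    then have card: "part_chi p < card ?A" using card_clique_colors[OF h p] by simp
    have "(F n, override_on (F n) f' (S p)) \<in> (recolor_step G ?l)\<^sup>*"
    proof (rule recolor_subset[OF graph part_subset[OF p] recolor_steps_in_colorings[OF IH fl] _ _ _ rec[OF p] card])
      show "?A \<subseteq> {1..?l}" using hk[OF _ p] by fastforce
      show "F n ` S p \<subseteq> ?A" using F_tight[OF p] by blast
      show "F n v \<notin> ?A" if uv: "(u, v) \<in> parcs G" "u \<in> S p" "v \<notin> S p" for u v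
      proof -
        obtain q where q: "q \<in> {1..m}" "q \<noteq> p" "v \<in> S q" "complete_to G (S p) (S q)"
          using neighbor_outside_part[OF p uv] by blast
        then have "h ` Q p \<inter> h ` Q q = {}" using skeleton_coloring_disjoint[OF h p q(1)] by blast
        moreover obtain y where y: "y \<in> Q q" "F n v = h y" using F_tight[OF q(1,3)] by blast
        moreover have "h y \<noteq> ?l" using hk[OF y(1) q(1)] by auto
        ultimately show ?thesis by (metis IntI empty_iff imageI insertE)
      qed
      show "f' ` S p \<subseteq> ?A" using tight(2)[OF p] by blast
    qed (use coloring_neq[OF f'] in blast)
    moreover have "override_on (F n) f' (S p) = F (Suc n)"
      by (auto simp: F_def p_def override_on_def fun_eq_iff le_Suc_eq)
    ultimately show ?case using IH by (metis rtrancl_trans)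
  qed
  \<comment> \<open>The parts cover the vertex set, and outside it both colorings are
    \<open>undefined\<close>.\<close>
  moreover have "F m = f'"
  proof
    show "F m x = f' x" for x
      unfolding F_def cover
      using coloring_extensional[OF f] coloring_extensional[OF f']
      by (cases "x \<in> pverts G") (auto simp: extensional_def)
  qed
  ultimately show ?thesis by (metis order_refl)
qed

section \<open>Equivalence of the two connectivity statements\<close>

text \<open>The colorings \<open>h0\<close> and \<open>f1\<close> serve as common targets. They use
  at most \<open>k\<close> colors and have matching color sets, so a transfer that ends with these
  color sets leaves \<open>Suc k\<close> free for the final adjustment.\<close>

theorem connected_recoloring_graph_skeleton_iff:
  assumes k: "chromatic_number G \<le> k"
    and rec: "\<And>p. p \<in> {1..m} \<Longrightarrow> recolorable (induced_on G (S p))"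
  shows "connected (with_proj (recoloring_graph G (Suc k))) \<longleftrightarrow>
    connected (with_proj (recoloring_graph H (Suc k)))"
proof -
  let ?l = "Suc k"
  obtain f0 where "f0 \<in> colorings G k" using colorings_nonempty[OF graph k] by blast
  then obtain h0 where h0: "h0 \<in> colorings H k" by (rule ex_skeleton_coloring)
  then obtain f1 where f1: "f1 \<in> colorings G k" "\<And>p. p \<in> {1..m} \<Longrightarrow> f1 ` S p \<subseteq> h0 ` Q p"
    by (rule ex_tight_coloring) blast
  have f1l: "f1 \<in> colorings G ?l" using f1 colorings_mono[of k ?l G] by auto
  have h0l: "h0 \<in> colorings H ?l" using h0 colorings_mono[of k ?l H] by auto
  show ?thesis
  proof
    assume conn: "connected (with_proj (recoloring_graph G ?l))"
    show "connected (with_proj (recoloring_graph H ?l))"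
    proof (rule connected_recoloring_graphI[OF h0l])
      fix h assume h: "h \<in> colorings H ?l"
      \<comment> \<open>On each part \<open>f\<close> shows exactly the colors of \<open>h\<close>,
        so the inclusion needed to follow the path from \<open>f\<close> to \<open>f1\<close> holds
        at the start.\<close>
      then obtain f where f: "f \<in> colorings G ?l" "\<And>p. p \<in> {1..m} \<Longrightarrow> f ` S p \<subseteq> h ` Q p"
        by (rule ex_tight_coloring) blast
      have "(f, f1) \<in> (recolor_step G ?l)\<^sup>*"
        using conn f(1) f1l unfolding connected_recoloring_graph_iff by blast
      moreover have "h ` Q p \<subseteq> f ` S p" if "p \<in> {1..m}" for p
        using tight_eq[OF f(1) h that f(2)[OF that]] by simp
      ultimately obtain g where g: "(h, g) \<in> (recolor_step H ?l)\<^sup>*" "\<forall>p \<in> {1..m}. g ` Q p \<subseteq> f1 ` S p"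
        using transfer_steps[OF _ h] by blast
      have sub: "g ` Q p \<subseteq> h0 ` Q p" if "p \<in> {1..m}" for p
        using g(2) f1(2)[OF that] that by blast
      have "g \<in> colorings H ?l" using recolor_steps_in_colorings[OF g(1) h] .
      then have "g \<in> colorings H k"
      proof (rule coloring_fewer_colors)
        show "g x \<in> {1..k}" if x: "x \<in> pverts H" for x
        proof -
          obtain p where p: "p \<in> {1..m}" "x \<in> Q p" using x by (auto simp: pverts_skeleton)
          then have "g x \<in> h0 ` Q p" using sub by blast
          then show ?thesis using clique_colors_range[OF h0 p(1)] by (rule rev_subsetD)
        qed
      qed
      then have "(g, h0) \<in> (recolor_step H ?l)\<^sup>*" using permute_cliques h0 sub by blast
      with g(1) show "(h, h0) \<in> (recolor_step H ?l)\<^sup>*" by (rule rtrancl_trans)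
    qed
  next
    assume conn: "connected (with_proj (recoloring_graph H ?l))"
    show "connected (with_proj (recoloring_graph G ?l))"
    proof (rule connected_recoloring_graphI[OF f1l])
      fix f assume f: "f \<in> colorings G ?l"
      obtain f' where f': "(f, f') \<in> (recolor_step G ?l)\<^sup>*"
        "\<And>p. p \<in> {1..m} \<Longrightarrow> card (f' ` S p) \<le> part_chi p"
        using shrink_parts[OF f rec] by blast
      have f'l: "f' \<in> colorings G ?l" using recolor_steps_in_colorings[OF f'(1) f] .
      then obtain h where h: "h \<in> colorings H ?l" "\<And>p. p \<in> {1..m} \<Longrightarrow> h ` Q p \<subseteq> f' ` S p"
        by (rule ex_skeleton_coloring) blast
      \<comment> \<open>After shrinking, the part has no more colors than the clique, so the colors
        chosen for the clique exhaust those of the part.\<close>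
      have tight: "f' ` S p \<subseteq> h ` Q p" if p: "p \<in> {1..m}" for p
        using card_seteq[OF _ h(2)[OF p]] finite_part[OF p] f'(2)[OF p] card_clique_colors[OF h(1) p]
        by simp
      have "(h, h0) \<in> (recolor_step H ?l)\<^sup>*"
        using conn h(1) h0l unfolding connected_recoloring_graph_iff by blast
      from lift_steps[OF this f'l tight]
      obtain g where g: "(f', g) \<in> (recolor_step G ?l)\<^sup>*" "\<forall>p \<in> {1..m}. g ` S p \<subseteq> h0 ` Q p"
        by blast
      have gl: "g \<in> colorings G ?l" using recolor_steps_in_colorings[OF g(1) f'l] .
      have g_tight: "g ` S p \<subseteq> h0 ` Q p" if "p \<in> {1..m}" for p using g(2) that by blast
      \<comment> \<open>The colors of \<open>g\<close> are among those of \<open>h0\<close>, which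
        avoids \<open>Suc k\<close>.\<close>
      have "g \<in> colorings G k"
        by (rule coloringI_skeleton[OF h0 coloring_extensional[OF gl] coloring_neq[OF gl] g_tight])
      then have "(g, f1) \<in> (recolor_step G ?l)\<^sup>*"
        by (rule tight_colorings_connected[OF _ f1(1) h0 g_tight f1(2) rec])
      with f'(1) g(1) show "(f, f1) \<in> (recolor_step G ?l)\<^sup>*" by (meson rtrancl_trans)
    qed
  qed
qed

end

theorem theorem10:
  fixes G :: "'a pair_pre_digraph"
    and S :: "nat \<Rightarrow> 'a set"
    and m l :: nat
    and H :: "(nat \<times> nat) pair_pre_digraph"
  assumes "pair_graph G"
    and "maximal_module_partition G S m"
    and "H = clique_skeleton G S m"
    and "l \<ge> chromatic_number G + 1"
    and "\<And>K :: 'a pair_pre_digraph.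
           induced_subgraph (with_proj K) (with_proj G) \<Longrightarrow> pverts K \<subset> pverts G \<Longrightarrow> recolorable K"
  shows "connected (with_proj (recoloring_graph G l)) \<longleftrightarrow>
         connected (with_proj (recoloring_graph H l))"
proof -
  have "pair_graph G" by fact
  then have wf: "pair_wf_digraph G" by (simp add: pair_graph_def pair_digraph_def pair_fin_digraph_def)
  interpret modular_partition G S m
  proof (rule modular_partition.intro)
    show "graph_module G (S p)" if "p \<in> {1..m}" for p
      using assms(2) that unfolding maximal_module_partition_def maximal_module_def by blast
    show "disjoint_family_on S {1..m}" "(\<Union>p \<in> {1..m}. S p) = pverts G"
      using assms(2) unfolding maximal_module_partition_def by blast+
  qed (rule assms(1))
  \<comment> \<open>The bound makes \<open>l\<close> positive; its predecessor \<open>k\<close>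
    still suffices to color \<open>G\<close>, which leaves one color spare.\<close>
  obtain k where k: "l = Suc k" "chromatic_number G \<le> k"
    using assms(4) by (cases l) auto
  have "recolorable (induced_on G (S p))" if p: "p \<in> {1..m}" for p
  proof (rule assms(5))
    show "induced_subgraph (with_proj (induced_on G (S p))) (with_proj G)"
      using induced_subgraph_induced_on[OF wf part_subset[OF p]] .
    \<comment> \<open>Maximal modules are proper subsets of the vertex set, so the assumption on
      proper induced subgraphs applies to each part.\<close>
    show "pverts (induced_on G (S p)) \<subset> pverts G"
      using assms(2) p by (simp add: induced_on_def maximal_module_partition_def maximal_module_def)
  qed
  then show ?thesis
    using connected_recoloring_graph_skeleton_iff[OF k(2)] by (simp add: assms(3) k(1))
qed

end
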